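(* For all $\alpha,\beta>0$, the determinant $|g(\alpha,\beta)|$ of the Fisher information metric matrix of the beta distributions satisfies $$|g(\alpha,\beta)|>\frac{1+\alpha+\beta}{2\alpha\beta(\alpha+\beta)^2}.$$
   Context: $\psi(x)=\frac{d}{dx}\ln\Gamma(x)$ is the digamma function and $\psi'$ is its derivative. The Fisher information metric matrix of the beta distributions $B(\alpha,\beta)$ (density $\frac{\Gamma(\alpha+\beta)}{\Gamma(\alpha)\Gamma(\beta)}x^{\alpha-1}(1-x)^{\beta-1}$ on $[0,1]$) in the coordinates $(\alpha,\beta)$ is $$g(\alpha,\beta)=\begin{pmatrix}\psi'(\alpha)-\psi'(\alpha+\beta) & -\psi'(\alpha+\beta)\\ -\psi'(\alpha+\beta) & \psi'(\beta)-\psi'(\alpha+\beta)\end{pmatrix},$$ and $|g(\alpha,\beta)|$ denotes its determinant. *)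

theory Defs
  imports "HOL-Analysis.Analysis"
begin

text \<open>
  \<^const>\<open>Digamma\<close> is the library's digamma function \<open>\<psi>\<close>, and \<open>Polygamma 1\<close> is its derivative
  (see the fact \<open>has_field_derivative_Polygamma\<close>).
\<close>

definition beta_metric :: "real \<Rightarrow> real \<Rightarrow> real^2^2" where
  "beta_metric \<alpha> \<beta> =
     vector [vector [Polygamma 1 \<alpha> - Polygamma 1 (\<alpha> + \<beta>), - Polygamma 1 (\<alpha> + \<beta>)],
             vector [- Polygamma 1 (\<alpha> + \<beta>), Polygamma 1 \<beta> - Polygamma 1 (\<alpha> + \<beta>)]]"

text \<open>
  The rest of the theory shows that this matrix is indeed the Fisher information of the family of
  beta densities, that is, the second moment matrix of the score.
\<close>

definition beta_density :: "real \<Rightarrow> real \<Rightarrow> real \<Rightarrow> real" where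
  "beta_density \<alpha> \<beta> x =
     indicator {0..1} x * (Gamma (\<alpha> + \<beta>) / (Gamma \<alpha> * Gamma \<beta>) *
       x powr (\<alpha> - 1) * (1 - x) powr (\<beta> - 1))"

definition score :: "(real^'n \<Rightarrow> real \<Rightarrow> real) \<Rightarrow> real^'n \<Rightarrow> 'n::finite \<Rightarrow> real \<Rightarrow> real" where
  "score p \<theta> i x = deriv (\<lambda>t. ln (p (\<theta> + t *\<^sub>R axis i 1) x)) 0"

definition fisher_information :: "(real^'n \<Rightarrow> real \<Rightarrow> real) \<Rightarrow> real^'n \<Rightarrow> real^('n::finite)^'n" where
  "fisher_information p \<theta> =
     (\<chi> i j. LINT x|lborel. p \<theta> x * (score p \<theta> i x * score p \<theta> j x))"

lemma moments_from_mgf: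
  fixes S w :: "real \<Rightarrow> real" and M M' :: "real \<Rightarrow> real"
  assumes meas: "S \<in> borel_measurable lborel" "w \<in> borel_measurable lborel"
    and w: "\<And>x. w x \<ge> 0" and K: "K > 0"
    and int: "\<And>t. \<bar>t\<bar> < K \<Longrightarrow> has_bochner_integral lborel (\<lambda>x. exp (t * S x) * w x) (M t)"
    and M': "\<And>t. \<bar>t\<bar> < K \<Longrightarrow> (M has_real_derivative M' t) (at t)"
    and M'': "(M' has_real_derivative m2) (at 0)"
  shows "has_bochner_integral lborel (\<lambda>x. S x * w x) (M' 0)"
    and "has_bochner_integral lborel (\<lambda>x. S x ^ 2 * w x) m2"
proof -
  note [measurable] = meas
  define f where "f = (\<lambda>t n x. (t * S x) ^ n / fact n * w x)"
  have f_abs: "norm (f t n x) = \<bar>t * S x\<bar> ^ n / fact n * w x" for t n x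
    using w[of x] by (simp add: f_def abs_mult power_abs)
  have f_abs_sums: "(\<lambda>n. norm (f t n x)) sums (exp \<bar>t * S x\<bar> * w x)" for t x
    unfolding f_abs using exp_converges[of "\<bar>t * S x\<bar>"]
    by (intro sums_mult2) (simp add: field_simps)
  have f_sums: "(\<lambda>n. f t n x) sums (exp (t * S x) * w x)" for t x
    unfolding f_def using exp_converges[of "t * S x"]
    by (intro sums_mult2) (simp add: field_simps)
  have E: "integrable lborel (\<lambda>x. exp \<bar>t * S x\<bar> * w x)" if "\<bar>t\<bar> < K" for t
  proof (rule Bochner_Integration.integrable_bound)
    show "integrable lborel (\<lambda>x. exp (t * S x) * w x + exp ((-t) * S x) * w x)"
      using int[of t] int[of "-t"] that
      by (intro Bochner_Integration.integrable_add) (auto simp: has_bochner_integral_iff)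
    have "exp \<bar>t * S x\<bar> \<le> exp (t * S x) + exp ((-t) * S x)" for x
      by (cases "t * S x \<ge> 0") auto
    hence "exp \<bar>t * S x\<bar> * w x \<le> exp (t * S x) * w x + exp ((-t) * S x) * w x" for x
      using w[of x] by (metis distrib_right mult_right_mono)
    thus "AE x in lborel. norm (exp \<bar>t * S x\<bar> * w x)
            \<le> norm (exp (t * S x) * w x + exp ((-t) * S x) * w x)"
      using w by (intro AE_I2) (simp add: abs_of_nonneg)
  qed measurable
  have f_int: "integrable lborel (f t n)" if "\<bar>t\<bar> < K" for t n
  proof (rule Bochner_Integration.integrable_bound[OF E[OF that]])
    have "norm (f t n x) \<le> exp \<bar>t * S x\<bar> * w x" for x
      using sum_le_suminf[OF sums_summable[OF f_abs_sums[of t x]], of "{n}"]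
        sums_unique[OF f_abs_sums[of t x]] by simp
    thus "AE x in lborel. norm (f t n x) \<le> norm (exp \<bar>t * S x\<bar> * w x)"
      using w by (intro AE_I2) (simp add: abs_of_nonneg)
  qed (simp add: f_def)
  define c where "c = (\<lambda>n. (LINT x|lborel. S x ^ n * w x) / fact n)"
  have c: "(LINT x|lborel. f t n x) = c n * t ^ n" for t n
  proof -
    have "(LINT x|lborel. f t n x) = (LINT x|lborel. (t ^ n / fact n) * (S x ^ n * w x))"
      by (simp add: f_def power_mult_distrib mult_ac)
    thus ?thesis by (simp add: c_def)
  qed
  have sums: "(\<lambda>n. c n * t ^ n) sums M t" if t: "\<bar>t\<bar> < K" for t
  proof -
    have "(\<lambda>n. LINT x|lborel. f t n x) sums (LINT x|lborel. (\<Sum>n. f t n x))"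
    proof (rule sums_integral)
      show "integrable lborel (f t n)" for n by (rule f_int[OF t])
      show "AE x in lborel. summable (\<lambda>n. norm (f t n x))"
        using f_abs_sums by (auto intro!: AE_I2 simp: sums_iff)
      show "summable (\<lambda>n. LINT x|lborel. norm (f t n x))"
      proof (rule summableI_nonneg_bounded)
        fix N
        have "(\<Sum>n<N. LINT x|lborel. norm (f t n x)) = (LINT x|lborel. (\<Sum>n<N. norm (f t n x)))"
          using f_int[OF t] by (subst Bochner_Integration.integral_sum) auto
        also have "\<dots> \<le> (LINT x|lborel. exp \<bar>t * S x\<bar> * w x)"
        proof (rule integral_mono)
          show "integrable lborel (\<lambda>x. \<Sum>n<N. norm (f t n x))"
            using f_int[OF t] by (intro Bochner_Integration.integrable_sum integrable_norm)
          show "(\<Sum>n<N. norm (f t n x)) \<le> exp \<bar>t * S x\<bar> * w x" for x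
            using sum_le_suminf[OF sums_summable[OF f_abs_sums[of t x]], of "{..<N}"]
              sums_unique[OF f_abs_sums[of t x]] by simp
        qed (rule E[OF t])
        finally show "(\<Sum>n<N. LINT x|lborel. norm (f t n x)) \<le> (LINT x|lborel. exp \<bar>t * S x\<bar> * w x)" .
      qed auto
    qed
    also have "(\<lambda>x. \<Sum>n. f t n x) = (\<lambda>x. exp (t * S x) * w x)"
      using f_sums by (auto simp: sums_iff)
    also have "(LINT x|lborel. exp (t * S x) * w x) = M t"
      using int[OF t] by (simp add: has_bochner_integral_iff)
    finally show ?thesis by (simp add: c)
  qed
  have sums': "(\<lambda>n. diffs c n * t ^ n) sums M' t" if t: "\<bar>t\<bar> < K" for t
    by (rule termdiffs_sums_strong[where K = K and f = M]) (use sums M' t in auto)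
  have sums'': "(\<lambda>n. diffs (diffs c) n * 0 ^ n) sums m2"
    by (rule termdiffs_sums_strong[where K = K and f = M']) (use sums' M'' K in auto)
  have "M' 0 = diffs c 0"
    using sums'[of 0] K by (simp add: sums_iff)
  hence 1: "(LINT x|lborel. S x * w x) = M' 0" by (simp add: diffs_def c_def)
  have "m2 = diffs (diffs c) 0"
    using sums'' by (simp add: sums_iff)
  hence 2: "(LINT x|lborel. S x ^ 2 * w x) = m2" by (simp add: diffs_def c_def numeral_2_eq_2)
  have *: "integrable lborel (\<lambda>x. S x ^ n * w x)" for n
  proof -
    have "integrable lborel (\<lambda>x. (fact n / (K/2) ^ n) * f (K/2) n x)"
      using f_int[of "K/2" n] K by (intro integrable_mult_right) auto
    also have "(\<lambda>x. (fact n / (K/2) ^ n) * f (K/2) n x) = (\<lambda>x. S x ^ n * w x)"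
      using K by (auto simp: f_def power_mult_distrib field_simps)
    finally show ?thesis .
  qed
  show "has_bochner_integral lborel (\<lambda>x. S x * w x) (M' 0)"
    using 1 *[of 1] by (simp add: has_bochner_integral_iff)
  show "has_bochner_integral lborel (\<lambda>x. S x ^ 2 * w x) m2"
    using 2 *[of 2] by (simp add: has_bochner_integral_iff)
qed

lemma beta_density_nonneg:
  assumes "\<alpha> > 0" "\<beta> > 0"
  shows "beta_density \<alpha> \<beta> x \<ge> 0"
  using assms Gamma_real_pos[of \<alpha>] Gamma_real_pos[of \<beta>] Gamma_real_pos[of "\<alpha> + \<beta>"]
  by (simp add: beta_density_def indicator_def)

lemma beta_density_measurable [measurable]: "beta_density \<alpha> \<beta> \<in> borel_measurable borel"
  unfolding beta_density_def by measurable

lemma has_bochner_integral_Beta: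
  assumes "a > 0" "b > (0::real)"
  shows "has_bochner_integral lborel
           (\<lambda>x. indicator {0..1} x * (x powr (a - 1) * (1 - x) powr (b - 1))) (Beta a b)"
proof -
  have "(\<integral>\<^sup>+x. ennreal (indicator {0..1} x * (x powr (a - 1) * (1 - x) powr (b - 1))) \<partial>lborel)
          = ennreal (Beta a b)"
    using nn_integral_has_integral_lebesgue[OF _ has_integral_Beta_real[OF assms]]
    by (simp add: mult_ac)
  moreover have "Beta a b \<ge> 0"
    using assms by (simp add: Beta_def Gamma_real_pos less_imp_le)
  ultimately show ?thesis
    by (intro has_bochner_integral_nn_integral) auto
qed

lemma beta_tilted:
  assumes ab: "\<alpha> > 0" "\<beta> > 0" "\<alpha> + t * u > 0" "\<beta> + t * v > 0"
  shows "has_bochner_integral lborel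
           (\<lambda>x. exp (t * (u * ln x + v * ln (1 - x))) * beta_density \<alpha> \<beta> x)
           (Beta (\<alpha> + t * u) (\<beta> + t * v) / Beta \<alpha> \<beta>)"
proof (rule iffD1[OF has_bochner_integral_cong_AE])
  show "has_bochner_integral lborel
          (\<lambda>x. (indicator {0..1} x * (x powr ((\<alpha> + t * u) - 1) * (1 - x) powr ((\<beta> + t * v) - 1)))
               / Beta \<alpha> \<beta>)
          (Beta (\<alpha> + t * u) (\<beta> + t * v) / Beta \<alpha> \<beta>)"
    by (rule has_bochner_integral_divide_zero[OF has_bochner_integral_Beta]) (use ab in auto)
  have "AE x in lborel. x \<noteq> 0 \<and> x \<noteq> (1::real)"
    by (intro AE_conjI AE_lborel_singleton)
  then show "AE x in lborel. (indicator {0..1} x *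
          (x powr ((\<alpha> + t * u) - 1) * (1 - x) powr ((\<beta> + t * v) - 1))) / Beta \<alpha> \<beta>
        = exp (t * (u * ln x + v * ln (1 - x))) * beta_density \<alpha> \<beta> x"
  proof eventually_elim
    case (elim x)
    show ?case
    proof (cases "x \<in> {0<..<1}")
      case True
      hence "x powr ((\<alpha> + t * u) - 1) = exp (t * (u * ln x)) * x powr (\<alpha> - 1)"
            "(1 - x) powr ((\<beta> + t * v) - 1) = exp (t * (v * ln (1 - x))) * (1 - x) powr (\<beta> - 1)"
        by (simp_all add: powr_def algebra_simps flip: exp_add)
      thus ?thesis using True
        by (simp add: beta_density_def Beta_def exp_add distrib_left)
    next
      case False
      with elim show ?thesis by (auto simp: beta_density_def indicator_def)
    qed
  qed
qed (simp_all add: beta_density_def)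

lemma beta_score_moment:
  fixes u v :: real
  assumes ab: "\<alpha> > 0" "\<beta> > 0"
  defines "m \<equiv> u * (Digamma \<alpha> - Digamma (\<alpha> + \<beta>)) + v * (Digamma \<beta> - Digamma (\<alpha> + \<beta>))"
  shows "has_bochner_integral lborel
           (\<lambda>x. beta_density \<alpha> \<beta> x * (u * ln x + v * ln (1 - x) - m) ^ 2)
           (u\<^sup>2 * Polygamma 1 \<alpha> + v\<^sup>2 * Polygamma 1 \<beta> - (u + v)\<^sup>2 * Polygamma 1 (\<alpha> + \<beta>))"
proof -
  define S where "S = (\<lambda>x::real. u * ln x + v * ln (1 - x))"
  define w where "w = beta_density \<alpha> \<beta>"
  define K where "K = min \<alpha> \<beta> / (\<bar>u\<bar> + \<bar>v\<bar> + 1)"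
  have K: "K > 0" using ab by (auto simp: K_def)
  have pos: "\<alpha> + t * u > 0" "\<beta> + t * v > 0" if "\<bar>t\<bar> < K" for t
  proof -
    have "\<bar>t\<bar> * (\<bar>u\<bar> + \<bar>v\<bar> + 1) < min \<alpha> \<beta>"
      using that by (simp add: K_def pos_less_divide_eq add_nonneg_pos)
    moreover have "\<bar>t * u\<bar> \<le> \<bar>t\<bar> * (\<bar>u\<bar> + \<bar>v\<bar> + 1)" "\<bar>t * v\<bar> \<le> \<bar>t\<bar> * (\<bar>u\<bar> + \<bar>v\<bar> + 1)"
      by (auto simp: abs_mult intro!: mult_left_mono)
    ultimately show "\<alpha> + t * u > 0" "\<beta> + t * v > 0" by linarith+
  qed
  define M where "M = (\<lambda>t. Beta (\<alpha> + t * u) (\<beta> + t * v) / Beta \<alpha> \<beta>)"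
  define L where "L = (\<lambda>t. u * Digamma (\<alpha> + t * u) + v * Digamma (\<beta> + t * v)
                            - (u + v) * Digamma (\<alpha> + \<beta> + t * (u + v)))"
  define V where "V = u\<^sup>2 * Polygamma 1 \<alpha> + v\<^sup>2 * Polygamma 1 \<beta> - (u + v)\<^sup>2 * Polygamma 1 (\<alpha> + \<beta>)"
  have B0: "Beta \<alpha> \<beta> > 0" using ab by (simp add: Beta_def Gamma_real_pos)
  have notnp: "x > 0 \<Longrightarrow> x \<notin> \<int>\<^sub>\<le>\<^sub>0" for x :: real
    by (auto elim!: nonpos_Ints_cases)
  have M': "(M has_real_derivative M t * L t) (at t)" if t: "\<bar>t\<bar> < K" for t
  proof -
    have p: "\<alpha> + t * u > 0" "\<beta> + t * v > 0" "\<alpha> + t * u + (\<beta> + t * v) > 0"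
      using pos[OF t] by auto
    have s: "\<alpha> + \<beta> + t * (u + v) = \<alpha> + t * u + (\<beta> + t * v)" by (simp add: algebra_simps)
    have g: "Gamma (\<alpha> + t * u + (\<beta> + t * v)) \<noteq> 0" using Gamma_real_pos[OF p(3)] by simp
    have "((\<lambda>t. Gamma (\<alpha> + t * u) * Gamma (\<beta> + t * v) / Gamma (\<alpha> + t * u + (\<beta> + t * v)) / Beta \<alpha> \<beta>)
            has_real_derivative M t * L t) (at t)"
      unfolding M_def L_def s Beta_def[of "\<alpha> + t * u"]
      using p notnp g B0
      by (auto intro!: derivative_eq_intros simp: field_simps)
    thus ?thesis by (simp add: M_def Beta_def)
  qed
  have L': "(L has_real_derivative V) (at 0)"
    unfolding L_def V_def using ab notnp
    by (auto intro!: derivative_eq_intros simp: power2_eq_square algebra_simps)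
  have M0: "M 0 = 1" and L0: "L 0 = m"
    using B0 by (auto simp: M_def L_def m_def algebra_simps)
  have M'': "((\<lambda>t. M t * L t) has_real_derivative (m\<^sup>2 + V)) (at 0)"
    using M'[of 0] L' K
    by (auto intro!: derivative_eq_intros simp: M0 L0 power2_eq_square)
  have int: "has_bochner_integral lborel (\<lambda>x. exp (t * S x) * w x) (M t)" if "\<bar>t\<bar> < K" for t
    unfolding S_def w_def M_def by (rule beta_tilted) (use ab pos[OF that] in auto)
  have 0: "has_bochner_integral lborel w 1"
    using int[of 0] K by (simp add: M0)
  have 1: "has_bochner_integral lborel (\<lambda>x. S x * w x) m"
    and 2: "has_bochner_integral lborel (\<lambda>x. S x ^ 2 * w x) (m\<^sup>2 + V)"
  proof -
    have meas: "S \<in> borel_measurable lborel" "w \<in> borel_measurable lborel"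
      by (simp_all add: S_def w_def)
    have wpos: "w x \<ge> 0" for x using beta_density_nonneg[OF ab] by (simp add: w_def)
    note * = moments_from_mgf[OF meas wpos K int M' M'']
    show "has_bochner_integral lborel (\<lambda>x. S x * w x) m"
      using *(1) by (simp add: M0 L0)
    show "has_bochner_integral lborel (\<lambda>x. S x ^ 2 * w x) (m\<^sup>2 + V)"
      using *(2) by simp
  qed
  have "has_bochner_integral lborel (\<lambda>x. S x ^ 2 * w x - 2 * m * (S x * w x) + m\<^sup>2 * w x)
          (m\<^sup>2 + V - 2 * m * m + m\<^sup>2 * 1)"
    by (intro has_bochner_integral_add has_bochner_integral_diff has_bochner_integral_mult_right 0 1 2)
  also have "(\<lambda>x. S x ^ 2 * w x - 2 * m * (S x * w x) + m\<^sup>2 * w x) = (\<lambda>x. w x * (S x - m) ^ 2)"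
    by (auto simp: power2_eq_square algebra_simps)
  also have "m\<^sup>2 + V - 2 * m * m + m\<^sup>2 * 1 = V"
    by (simp add: power2_eq_square)
  finally show ?thesis by (simp add: S_def w_def V_def)
qed

lemma score_beta:
  fixes \<alpha> \<beta> u v x :: real
  assumes ab: "\<alpha> > 0" "\<beta> > 0" and x: "x \<in> {0<..<1}"
  shows "deriv (\<lambda>t. ln (beta_density (\<alpha> + t * u) (\<beta> + t * v) x)) 0 =
           u * ln x + v * ln (1 - x)
           - (u * (Digamma \<alpha> - Digamma (\<alpha> + \<beta>)) + v * (Digamma \<beta> - Digamma (\<alpha> + \<beta>)))"
proof (rule DERIV_imp_deriv)
  have notnp: "z > 0 \<Longrightarrow> z \<notin> \<int>\<^sub>\<le>\<^sub>0" for z :: real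
    by (auto elim!: nonpos_Ints_cases)
  define G where "G = Gamma (\<alpha> + \<beta>) / (Gamma \<alpha> * Gamma \<beta>) * x powr (\<alpha> - 1) * (1 - x) powr (\<beta> - 1)"
  have G: "G > 0" using ab x by (simp add: G_def Gamma_real_pos)
  have nz: "Gamma (\<alpha> + \<beta>) \<noteq> 0" "Gamma \<alpha> \<noteq> 0" "Gamma \<beta> \<noteq> 0"
    using ab by (simp_all add: Gamma_eq_zero_iff notnp)
  have "((\<lambda>t. Gamma ((\<alpha> + t * u) + (\<beta> + t * v)) / (Gamma (\<alpha> + t * u) * Gamma (\<beta> + t * v)) *
            x powr ((\<alpha> + t * u) - 1) * (1 - x) powr ((\<beta> + t * v) - 1)) has_real_derivative
          G * (u * ln x + v * ln (1 - x)
           - (u * (Digamma \<alpha> - Digamma (\<alpha> + \<beta>)) + v * (Digamma \<beta> - Digamma (\<alpha> + \<beta>))))) (at 0)"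
    unfolding G_def using ab x notnp nz
    by (auto intro!: derivative_eq_intros simp: field_simps)
  note D = this
  have "((\<lambda>t. ln (Gamma ((\<alpha> + t * u) + (\<beta> + t * v)) / (Gamma (\<alpha> + t * u) * Gamma (\<beta> + t * v)) *
            x powr ((\<alpha> + t * u) - 1) * (1 - x) powr ((\<beta> + t * v) - 1))) has_real_derivative
          inverse G * (G * (u * ln x + v * ln (1 - x)
           - (u * (Digamma \<alpha> - Digamma (\<alpha> + \<beta>)) + v * (Digamma \<beta> - Digamma (\<alpha> + \<beta>)))))) (at 0)"
  proof (rule DERIV_chain2[where f = ln, OF _ D])
    show "(ln has_real_derivative inverse G)
        (at (Gamma ((\<alpha> + 0 * u) + (\<beta> + 0 * v)) / (Gamma (\<alpha> + 0 * u) * Gamma (\<beta> + 0 * v)) *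
            x powr ((\<alpha> + 0 * u) - 1) * (1 - x) powr ((\<beta> + 0 * v) - 1)))"
      using DERIV_ln[OF G] by (simp add: G_def)
  qed
  moreover have "inverse G * (G * z) = z" for z using G by simp
  ultimately show "((\<lambda>t. ln (beta_density (\<alpha> + t * u) (\<beta> + t * v) x)) has_real_derivative
          u * ln x + v * ln (1 - x)
           - (u * (Digamma \<alpha> - Digamma (\<alpha> + \<beta>)) + v * (Digamma \<beta> - Digamma (\<alpha> + \<beta>)))) (at 0)"
    using x by (simp add: beta_density_def)
qed

theorem fisher_information_beta:
  assumes ab: "\<alpha> > 0" "\<beta> > 0"
  shows "fisher_information (\<lambda>\<theta>. beta_density (\<theta> $ 1) (\<theta> $ 2)) (vector [\<alpha>, \<beta>]) = beta_metric \<alpha> \<beta>"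
proof -
  define p :: "real^2 \<Rightarrow> real \<Rightarrow> real" where "p = (\<lambda>\<theta>. beta_density (\<theta> $ 1) (\<theta> $ 2))"
  define \<theta> :: "real^2" where "\<theta> = vector [\<alpha>, \<beta>]"
  define w where "w = beta_density \<alpha> \<beta>"
  define S1 where "S1 = (\<lambda>x. ln x - (Digamma \<alpha> - Digamma (\<alpha> + \<beta>)))"
  define S2 where "S2 = (\<lambda>x. ln (1 - x) - (Digamma \<beta> - Digamma (\<alpha> + \<beta>)))"
  have p\<theta>: "p \<theta> = w" by (simp add: p_def \<theta>_def w_def)
  have s1: "score p \<theta> 1 x = S1 x" and s2: "score p \<theta> 2 x = S2 x" if "x \<in> {0<..<1}" for x
    using score_beta[OF ab that, of 1 0] score_beta[OF ab that, of 0 1]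
    by (simp_all add: score_def p_def \<theta>_def S1_def S2_def axis_def)
  have cong: "(LINT x|lborel. w x * (score p \<theta> i x * score p \<theta> j x)) = (LINT x|lborel. w x * (A x * B x))"
    if "\<And>x. x \<in> {0<..<1} \<Longrightarrow> score p \<theta> i x = A x" "\<And>x. x \<in> {0<..<1} \<Longrightarrow> score p \<theta> j x = B x"
    for i j A B
  proof (rule Bochner_Integration.integral_cong[OF refl])
    fix x :: real
    have "w x = 0" if "x \<notin> {0<..<1}"
      using that by (auto simp: w_def beta_density_def indicator_def)
    thus "w x * (score p \<theta> i x * score p \<theta> j x) = w x * (A x * B x)"
      using that by (cases "x \<in> {0<..<1}") auto
  qed
  have I1: "has_bochner_integral lborel (\<lambda>x. w x * S1 x ^ 2) (Polygamma 1 \<alpha> - Polygamma 1 (\<alpha> + \<beta>))"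
    using beta_score_moment[OF ab, of 1 0] by (simp add: S1_def w_def)
  have I2: "has_bochner_integral lborel (\<lambda>x. w x * S2 x ^ 2) (Polygamma 1 \<beta> - Polygamma 1 (\<alpha> + \<beta>))"
    using beta_score_moment[OF ab, of 0 1] by (simp add: S2_def w_def)
  have I3: "has_bochner_integral lborel (\<lambda>x. w x * (S1 x + S2 x) ^ 2)
              (Polygamma 1 \<alpha> + Polygamma 1 \<beta> - 4 * Polygamma 1 (\<alpha> + \<beta>))"
    using beta_score_moment[OF ab, of 1 1] by (simp add: S1_def S2_def w_def algebra_simps)
  have "has_bochner_integral lborel
          (\<lambda>x. (w x * (S1 x + S2 x) ^ 2 - w x * S1 x ^ 2 - w x * S2 x ^ 2) / 2)
          (((Polygamma 1 \<alpha> + Polygamma 1 \<beta> - 4 * Polygamma 1 (\<alpha> + \<beta>))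
             - (Polygamma 1 \<alpha> - Polygamma 1 (\<alpha> + \<beta>)) - (Polygamma 1 \<beta> - Polygamma 1 (\<alpha> + \<beta>))) / 2)"
    by (intro has_bochner_integral_divide_zero has_bochner_integral_diff I1 I2 I3)
  hence I12: "has_bochner_integral lborel (\<lambda>x. w x * (S1 x * S2 x)) (- Polygamma 1 (\<alpha> + \<beta>))"
    by (simp add: power2_eq_square algebra_simps)
  have e11: "fisher_information p \<theta> $ 1 $ 1 = Polygamma 1 \<alpha> - Polygamma 1 (\<alpha> + \<beta>)"
    using I1 cong[OF s1 s1]
    by (simp add: fisher_information_def p\<theta> has_bochner_integral_iff power2_eq_square)
  have e22: "fisher_information p \<theta> $ 2 $ 2 = Polygamma 1 \<beta> - Polygamma 1 (\<alpha> + \<beta>)"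
    using I2 cong[OF s2 s2]
    by (simp add: fisher_information_def p\<theta> has_bochner_integral_iff power2_eq_square)
  have e12: "fisher_information p \<theta> $ 1 $ 2 = - Polygamma 1 (\<alpha> + \<beta>)"
    using I12 cong[OF s1 s2] by (simp add: fisher_information_def p\<theta> has_bochner_integral_iff)
  have e21: "fisher_information p \<theta> $ 2 $ 1 = - Polygamma 1 (\<alpha> + \<beta>)"
    using I12 cong[OF s2 s1]
    by (simp add: fisher_information_def p\<theta> has_bochner_integral_iff mult.commute)
  have "fisher_information p \<theta> = beta_metric \<alpha> \<beta>"
    using e11 e12 e21 e22 by (simp add: vec_eq_iff forall_2 beta_metric_def)
  thus ?thesis by (simp add: p_def \<theta>_def)
qed

end

theory Submission
  imports Defs "HOL-Real_Asymp.Real_Asymp"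
begin

text \<open>
  Write \<open>T\<close> for the trigamma function \<open>Polygamma 1\<close> and \<open>s = \<alpha> + \<beta>\<close>. The determinant is
  \<open>T \<alpha> * T \<beta> - T s * (T \<alpha> + T \<beta>)\<close>, and the bound to be proved is exactly what this expression
  becomes when \<open>T\<close> is replaced by the first two terms \<open>L x = 1 / x + 1 / (2 * x\<^sup>2)\<close> of its
  asymptotic expansion at infinity (\<open>trigamma_leading_det\<close>). So everything depends on the
  remainder \<open>e = T - L\<close>.

  The determinant for \<open>T = L + e\<close> minus the determinant for \<open>L\<close> is
  \<open>e \<alpha> * e \<beta> - e s * (e \<alpha> + e \<beta>) + (L \<beta> - L s) * e \<alpha> + (L \<alpha> - L s) * e \<beta> - e s * (L \<alpha> + L \<beta>)\<close>.
  The negative terms containing \<open>e s\<close> are absorbed by the others as soon as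
  \<open>e s\<close> is small enough compared with \<open>e \<alpha>\<close> and \<open>e \<beta>\<close>, and it suffices that
  \<open>e\<close> is positive and that \<open>x\<^sup>2 * e x\<close> is decreasing (\<open>det_perturbation\<close>).

  Both properties of \<open>e\<close> come from comparing the series \<open>T x = (\<Sum>k. 1 / (x + k)\<^sup>2)\<close> with
  telescoping series. Positivity is the fact that the trapezoidal rule overestimates the integral
  of the convex function \<open>1 / y\<^sup>2\<close>. The monotonicity of \<open>x\<^sup>2 * e x = x\<^sup>2 * T x - x - 1 / 2\<close>
  amounts to \<open>2 * T x + x * T' x \<le> 1 / x\<close>, whose left-hand side is the series
  \<open>\<Sum>k. 2 * k / (x + k)^3\<close>; here \<open>1 / x\<close> is the value of the corresponding integral over \<open>k\<close>.
\<close>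

section \<open>Two inequalities for the trigamma function\<close>

definition trigamma_leading :: "real \<Rightarrow> real" where
  "trigamma_leading x = 1 / x + 1 / (2 * x\<^sup>2)"

definition trigamma_remainder :: "real \<Rightarrow> real" where
  "trigamma_remainder x = Polygamma 1 x - trigamma_leading x"

lemma trigamma_sums:
  fixes x :: real
  assumes "x > 0"
  shows "(\<lambda>k. 1 / (x + real k)\<^sup>2) sums Polygamma 1 x"
  using Polygamma_LIMSEQ[of x 1] assms by (simp add: inverse_eq_divide power2_eq_square)

lemma Polygamma_2_sums:
  fixes x :: real
  assumes "x > 0"
  shows "(\<lambda>k. 2 / (x + real k) ^ 3) sums (- Polygamma 2 x)"
proof -
  have "(\<lambda>k. 2 * inverse ((x + real k) ^ Suc 2)) sums (2 * ((- 1) ^ Suc 2 * Polygamma 2 x / fact 2))"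
    using assms by (intro sums_mult Polygamma_LIMSEQ) auto
  then show ?thesis
    by (simp add: inverse_eq_divide fact_numeral eval_nat_numeral)
qed

text \<open>
  As a function of \<open>y = x + k\<close>, \<open>1 / y + 1 / (2 * y\<^sup>2)\<close> is the tail integral of \<open>1 / y\<^sup>2\<close> plus
  half of the term \<open>1 / y\<^sup>2\<close>. So its decrement from \<open>y\<close> to \<open>y + 1\<close> falls short of the term
  \<open>1 / y\<^sup>2\<close> by the error of the trapezoidal rule on \<open>[y, y + 1]\<close>, which is the square
  \<open>(1 / y - 1 / (y + 1))\<^sup>2 / 2\<close>.
\<close>

lemma trigamma_remainder_pos:
  assumes x: "x > 0"
  shows "trigamma_remainder x > 0"
proof -
  define F where "F = (\<lambda>k. trigamma_leading (x + real k))"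
  have "F \<longlonglongrightarrow> 0"
    unfolding F_def trigamma_leading_def by real_asymp
  from telescope_sums'[OF this] have F: "(\<lambda>k. F k - F (Suc k)) sums trigamma_leading x"
    by (simp add: F_def)
  have eq: "1 / (x + real k)\<^sup>2 - (F k - F (Suc k))
      = (1 / (x + real k) - 1 / (x + real k + 1))\<^sup>2 / 2" for k
  proof -
    define y where "y = x + real k"
    have y: "y > 0" using x by (simp add: y_def)
    have "1 / y\<^sup>2 - (trigamma_leading y - trigamma_leading (y + 1)) = (1 / y - 1 / (y + 1))\<^sup>2 / 2"
      using y unfolding trigamma_leading_def
      by (simp add: divide_simps) (simp add: algebra_simps power2_eq_square)
    then show ?thesis by (simp add: F_def y_def add_ac)
  qed
  have S: "(\<lambda>k. (1 / (x + real k) - 1 / (x + real k + 1))\<^sup>2 / 2) sums trigamma_remainder x"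
    using sums_diff[OF trigamma_sums[OF x] F] by (simp only: eq trigamma_remainder_def)
  have pos: "(1 / (x + real k) - 1 / (x + real k + 1))\<^sup>2 / 2 > 0" for k
  proof -
    have "1 / (x + real k + 1) < 1 / (x + real k)"
      using x by (intro divide_strict_left_mono) auto
    then show ?thesis by simp
  qed
  show ?thesis
    using suminf_pos[OF sums_summable[OF S]] pos sums_unique[OF S] by metis
qed

text \<open>
  The majorant is again a telescoping sum. In terms of \<open>y = x + k\<close> the terms are
  \<open>f = 2 * (y - x) / y^3\<close>; their tail integral is \<open>2 / y - x / y\<^sup>2\<close>, and \<open>f / 2 = (y - x) / y^3\<close>
  is the trapezoidal correction. Where \<open>f\<close> is convex, for \<open>y \<ge> 2 * x\<close>, the trapezoidal rule
  overestimates the integral, so there the decrements of these two parts are too small. The extra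
  term \<open>(y - x) / (2 * y^4)\<close> makes up for that deficit, and since it vanishes at \<open>y = x\<close> the
  initial value is still \<open>1 / x\<close>.
\<close>

lemma trigamma_deriv_bound:
  fixes x :: real
  assumes x: "x > 0"
  shows "2 * Polygamma 1 x + x * Polygamma 2 x \<le> 1 / x"
proof -
  define F where "F = (\<lambda>y. 2 / y - x / y\<^sup>2 + (y - x) / y ^ 3 + (y - x) / (2 * y ^ 4))"
  have "(\<lambda>k. F (x + real k)) \<longlonglongrightarrow> 0"
    unfolding F_def by real_asymp
  moreover have "F x = 1 / x"
    using x by (simp add: F_def power2_eq_square)
  ultimately have F: "(\<lambda>k. F (x + real k) - F (x + real (Suc k))) sums (1 / x)"
    using telescope_sums'[of "\<lambda>k. F (x + real k)" 0] by simp
  have S: "(\<lambda>k. 2 * (1 / (x + real k)\<^sup>2) - x * (2 / (x + real k) ^ 3)) sums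
      (2 * Polygamma 1 x - x * (- Polygamma 2 x))"
    by (intro sums_diff sums_mult trigamma_sums Polygamma_2_sums x)
  have "2 * (1 / y\<^sup>2) - x * (2 / y ^ 3) \<le> F y - F (y + 1)" if y: "y \<ge> x" for y
  proof -
    have y0: "y > 0" "y + 1 > 0" using x y by auto
    have "F y - F (y + 1) - (2 * (1 / y\<^sup>2) - x * (2 / y ^ 3))
        = (y ^ 3 * (y + 2) + (y - x) * (2 * y + 1)) / (2 * y ^ 4 * (y + 1) ^ 4)"
      using y0 unfolding F_def
      by (simp add: divide_simps) (simp add: algebra_simps eval_nat_numeral)
    also have "\<dots> \<ge> 0"
      using x y by (intro divide_nonneg_nonneg add_nonneg_nonneg mult_nonneg_nonneg) auto
    finally show ?thesis by simp
  qed
  from this[of "x + real k" for k]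
  have "2 * Polygamma 1 x - x * (- Polygamma 2 x) \<le> 1 / x"
    by (intro sums_le[OF _ S F]) (simp add: add_ac)
  then show ?thesis by simp
qed

lemma square_mult_trigamma_remainder_antimono:
  assumes "0 < x" "x \<le> y"
  shows "y\<^sup>2 * trigamma_remainder y \<le> x\<^sup>2 * trigamma_remainder x"
proof -
  have "y\<^sup>2 * Polygamma 1 y - y \<le> x\<^sup>2 * Polygamma 1 x - x"
  proof (rule DERIV_nonpos_imp_nonincreasing[OF \<open>x \<le> y\<close>])
    fix t assume "x \<le> t" "t \<le> y"
    then have t: "t > 0" using assms by simp
    then have "t \<notin> \<int>\<^sub>\<le>\<^sub>0" by (auto elim!: nonpos_Ints_cases)
    then have "((\<lambda>x. x\<^sup>2 * Polygamma 1 x - x) has_real_derivative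
        t * (2 * Polygamma 1 t + t * Polygamma 2 t) - 1) (at t)"
      by (auto intro!: derivative_eq_intros simp: algebra_simps power2_eq_square numeral_2_eq_2)
    moreover have "t * (2 * Polygamma 1 t + t * Polygamma 2 t) - 1 \<le> 0"
      using mult_left_mono[OF trigamma_deriv_bound[OF t], of t] t by simp
    ultimately show "\<exists>D. ((\<lambda>x. x\<^sup>2 * Polygamma 1 x - x) has_real_derivative D) (at t) \<and> D \<le> 0"
      by blast
  qed
  moreover have "z\<^sup>2 * trigamma_remainder z = z\<^sup>2 * Polygamma 1 z - z - 1 / 2" if "z > 0" for z
    using that by (simp add: trigamma_remainder_def trigamma_leading_def field_simps power2_eq_square)
  ultimately show ?thesis using assms by simp
qed

section \<open>The determinant\<close>

lemma det_beta_metric: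
  "det (beta_metric \<alpha> \<beta>) =
     Polygamma 1 \<alpha> * Polygamma 1 \<beta> - Polygamma 1 (\<alpha> + \<beta>) * (Polygamma 1 \<alpha> + Polygamma 1 \<beta>)"
  by (simp add: det_2 beta_metric_def algebra_simps)

lemma trigamma_leading_det:
  assumes "a > 0" "b > 0"
  shows "trigamma_leading a * trigamma_leading b
           - trigamma_leading (a + b) * (trigamma_leading a + trigamma_leading b)
         = (1 + a + b) / (2 * a * b * (a + b)\<^sup>2)"
  using assms add_pos_pos[OF assms] unfolding trigamma_leading_def
  by (simp add: divide_simps) (simp add: algebra_simps power2_eq_square)

text \<open>
  The factor \<open>1 - a\<^sup>2 / (a + b)\<^sup>2\<close> is what remains of the weight of \<open>e a\<close> once \<open>e (a + b)\<close> has
  been replaced by \<open>a\<^sup>2 / (a + b)\<^sup>2 * e a\<close>. In the form \<open>x * trigamma_leading x = 1 + 1 / (2 * x)\<close>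
  the inequality is clear: \<open>1 + 1 / (2 * x)\<close> decreases in \<open>x\<close>, and
  \<open>b * (b + 2 * a) / (a + b)\<^sup>2 > b / (a + b)\<close>.
\<close>

lemma trigamma_leading_gap:
  assumes "a > 0" "b > 0"
  shows "trigamma_leading (a + b) < trigamma_leading b * (1 - a\<^sup>2 / (a + b)\<^sup>2)"
proof -
  have "trigamma_leading b * (1 - a\<^sup>2 / (a + b)\<^sup>2) - trigamma_leading (a + b)
      = a * (b + 1) / (b * (a + b)\<^sup>2)"
    using assms add_pos_pos[OF assms] unfolding trigamma_leading_def
    by (simp add: divide_simps) (simp add: algebra_simps power2_eq_square)
  also have "\<dots> > 0" using assms by simp
  finally show ?thesis by simp
qed

text \<open>
  The two bounds on \<open>e (a + b)\<close> are used crosswise: the product with \<open>trigamma_leading b\<close> is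
  bounded through \<open>e a\<close>, since \<open>e a\<close> is also what multiplies \<open>trigamma_leading b\<close> in the
  expansion, and symmetrically. In the quadratic part the same choice leaves
  \<open>1 - (a\<^sup>2 + b\<^sup>2) / (a + b)\<^sup>2 \<ge> 0\<close>.
\<close>

lemma det_perturbation:
  fixes a b :: real and e :: "real \<Rightarrow> real"
  defines "L \<equiv> trigamma_leading" and "s \<equiv> a + b"
  assumes ab: "a > 0" "b > 0"
    and e: "e a > 0" "e b > 0" "s\<^sup>2 * e s \<le> a\<^sup>2 * e a" "s\<^sup>2 * e s \<le> b\<^sup>2 * e b"
  shows "(L a + e a) * (L b + e b) - (L s + e s) * ((L a + e a) + (L b + e b))
           > L a * L b - L s * (L a + L b)"
proof -
  define p where "p = a\<^sup>2 / s\<^sup>2"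
  define q where "q = b\<^sup>2 / s\<^sup>2"
  have s: "s > 0" using ab by (simp add: s_def)
  have La: "L a > 0" and Lb: "L b > 0"
    using ab by (simp_all add: L_def trigamma_leading_def add_pos_pos)
  have ep: "e s \<le> p * e a" and eq: "e s \<le> q * e b"
    using e s by (simp_all add: p_def q_def field_simps)
  have gap: "L s < L b * (1 - p)" "L s < L a * (1 - q)"
    using trigamma_leading_gap[of a b] trigamma_leading_gap[of b a] ab
    by (simp_all add: L_def s_def p_def q_def add.commute)
  have pq: "p + q \<le> 1"
  proof -
    have "a\<^sup>2 + b\<^sup>2 \<le> s\<^sup>2" using ab by (simp add: s_def power2_sum)
    then show ?thesis using s by (simp add: p_def q_def flip: add_divide_distrib)
  qed
  have "e s * L b \<le> p * e a * L b" "e s * L a \<le> q * e b * L a"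
    using ep eq La Lb by (simp_all add: mult_right_mono)
  moreover have "L s * e a < L b * (1 - p) * e a" "L s * e b < L a * (1 - q) * e b"
    using gap e by (simp_all add: mult_strict_right_mono)
  moreover have "e s * e b \<le> p * e a * e b" "e s * e a \<le> q * e b * e a"
    using ep eq e by (simp_all add: mult_right_mono)
  moreover have "(p + q) * (e a * e b) \<le> 1 * (e a * e b)"
    using pq e by (intro mult_right_mono) auto
  ultimately show ?thesis by (simp add: algebra_simps)
qed

theorem proposition7:
  fixes \<alpha> \<beta> :: real
  assumes "\<alpha> > 0" and "\<beta> > 0"
  shows "det (beta_metric \<alpha> \<beta>) > (1 + \<alpha> + \<beta>) / (2 * \<alpha> * \<beta> * (\<alpha> + \<beta>)\<^sup>2)"
proof -
  have "Polygamma 1 x = trigamma_leading x + trigamma_remainder x" for x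
    by (simp add: trigamma_remainder_def)
  then show ?thesis
    using det_perturbation[of \<alpha> \<beta> trigamma_remainder] assms
    by (simp add: det_beta_metric trigamma_remainder_pos
          square_mult_trigamma_remainder_antimono flip: trigamma_leading_det)
qed

end
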